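(* Let $A_0\in\mathbb{C}^{n\times n}$ have a simple eigenvalue $\lambda_0$ with right eigenvector $x_0\neq 0$ (so $A_0x_0=\lambda_0x_0$) and left eigenvector $y_0\neq 0$ (so $y_0^*A_0=\lambda_0y_0^*$), normalized so that $y_0^*x_0=1$. Let $\tau_0\in\mathbb{C}$ and let $A(\tau)\in\mathbb{C}^{n\times n}$ be a matrix-valued function of a complex parameter $\tau$ that is analytic in a neighborhood of $\tau_0$ and satisfies $A(\tau_0)=A_0$. Let $X_1,Y_1\in\mathbb{C}^{n\times(n-1)}$ and $B_1\in\mathbb{C}^{(n-1)\times(n-1)}$ be matrices such that, with $X=[x_0,X_1]$ and $Y=[y_0,Y_1]$, $$Y^*X=I_n\quad\text{and}\quad Y^*A_0X=\begin{bmatrix}\lambda_0&0\\0&B_1\end{bmatrix},$$ and define $$S=X_1(B_1-\lambda_0I_{n-1})^{-1}Y_1^*.$$ Let $\lambda(\tau)$ be the unique eigenvalue of $A(\tau)$ that is analytic in a neighborhood of $\tau_0$ with $\lambda(\tau_0)=\lambda_0$. Then there exist vector-valued functions $x(\tau)$ and $y(\tau)^*$ that are analytic in a neighborhood of $\tau_0$, with $x(\tau_0)=x_0$, $y(\tau_0)=y_0$ and $y(\tau)^*x(\tau)=1$, satisfying the right and left eigenvector equations $$A(\tau)x(\tau)=\lambda(\tau)x(\tau),\qquad y(\tau)^*A(\tau)=\lambda(\tau)y(\tau)^*.$$ Furthermore, these functions can be chosen so that their derivatives $x'(\tau)$ and $(y^* )'(\tau)$ satisfy $y_0^*x'(\tau_0)=0$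 and $(y^* )'(\tau_0)x_0=0$, with $$x'(\tau_0)=-SA'(\tau_0)x_0,\qquad (y^* )'(\tau_0)=-y_0^*A'(\tau_0)S.$$
   Context: The superscript $*$ denotes complex conjugate transpose and $I_k$ is the identity matrix of order $k$. An eigenvalue is simple if its algebraic multiplicity is one. A matrix or vector function of $\tau$ is analytic if each of its entries is analytic (complex differentiable) in $\tau$ in a neighborhood of $\tau_0$. It is the row vector function $\tau\mapsto y(\tau)^*$ (not $y(\tau)$) that is analytic, and $(y^* )'(\tau_0)$ means $\frac{d}{d\tau}\bigl(y(\tau)^*\bigr)\big|_{\tau=\tau_0}$. Matrices $X_1,Y_1,B_1$ as described always exist; since $\lambda_0$ is simple, it is not an eigenvalue of $B_1$, so $B_1-\lambda_0I_{n-1}$ is invertible. The existence and uniqueness of the analytic eigenvalue $\lambda(\tau)$ near $\tau_0$ with $\lambda(\tau_0)=\lambda_0$ is a known consequence of the simplicity of $\lambda_0$. *)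

theory Defs
  imports
    "HOL-Analysis.Complex_Analysis_Basics"
    "Jordan_Normal_Form.Schur_Decomposition"
    "Jordan_Normal_Form.Gauss_Jordan_Elimination"
begin

no_notation inner (infix "\<bullet>" 70)

text \<open>Row vectors are represented by the type of vectors as well; a conjugate transposed vector
  \<open>y\<^sup>*\<close> is \<open>conjugate y\<close>, used to the left of \<open>\<bullet>\<close> or of the following product.\<close>

definition vec_mult_mat :: "'a :: semiring_0 vec \<Rightarrow> 'a mat \<Rightarrow> 'a vec" (infixl "\<^sub>v*" 70) where
  "v \<^sub>v* M = vec (dim_col M) (\<lambda>j. v \<bullet> col M j)"

definition simple_eigenvalue :: "complex mat \<Rightarrow> complex \<Rightarrow> bool" where
  "simple_eigenvalue M k \<longleftrightarrow> eigenvalue M k \<and> Polynomial.order k (char_poly M) = 1"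

text \<open>Dimensions are not part of the types, so analyticity at \<open>t\<close> includes that the values
  have the stated format in a neighbourhood of \<open>t\<close>. By the definition of
  \<^const>\<open>analytic_on\<close>, analyticity on a singleton means complex differentiability in a ball
  around the point.\<close>

definition vec_analytic_at :: "nat \<Rightarrow> (complex \<Rightarrow> complex vec) \<Rightarrow> complex \<Rightarrow> bool" where
  "vec_analytic_at n v t \<longleftrightarrow>
     (\<forall>\<^sub>F s in nhds t. v s \<in> carrier_vec n) \<and>
     (\<forall>i<n. (\<lambda>s. v s $ i) analytic_on {t})"

definition mat_analytic_at ::
    "nat \<Rightarrow> nat \<Rightarrow> (complex \<Rightarrow> complex mat) \<Rightarrow> complex \<Rightarrow> bool" where
  "mat_analytic_at m n M t \<longleftrightarrow>
     (\<forall>\<^sub>F s in nhds t. M s \<in> carrier_mat m n) \<and>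
     (\<forall>i<m. \<forall>j<n. (\<lambda>s. M s $$ (i, j)) analytic_on {t})"

definition vec_deriv :: "(complex \<Rightarrow> complex vec) \<Rightarrow> complex \<Rightarrow> complex vec" where
  "vec_deriv v t = vec (dim_vec (v t)) (\<lambda>i. deriv (\<lambda>s. v s $ i) t)"

definition mat_deriv :: "(complex \<Rightarrow> complex mat) \<Rightarrow> complex \<Rightarrow> complex mat" where
  "mat_deriv M t =
     mat (dim_row (M t)) (dim_col (M t)) (\<lambda>(i, j). deriv (\<lambda>s. M s $$ (i, j)) t)"

end

theory Submission
  imports Defs
begin

text \<open>Put \<open>M = A\<^sub>0 - \<lambda>\<^sub>0\<close> and \<open>w = conjugate y\<^sub>0\<close>, so that \<open>P = x\<^sub>0 w\<^sup>T\<close> is the spectral projector of the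
  simple eigenvalue. The matrix \<open>S\<close> of the theorem is the group inverse of \<open>M\<close>: it satisfies
  \<open>S M = M S = 1 - P\<close> and \<open>S P = P S = 0\<close>. In the coordinates given by \<open>X\<close> and \<open>Y\<close> this is a statement
  about block diagonal matrices (\<open>group_inverse_of_block_diagonal\<close>); simplicity of \<open>\<lambda>\<^sub>0\<close> is what
  makes the lower block of \<open>M\<close> invertible (\<open>simple_eigenvalue_deflated_invertible\<close>).

  The bordered matrix \<open>G(\<tau>) = A(\<tau>) - \<lambda>(\<tau>) + P\<close> is invertible at \<open>\<tau>\<^sub>0\<close>, hence nearby. Any eigenvector
  \<open>v\<close> of \<open>A(\<tau>)\<close> for \<open>\<lambda>(\<tau>)\<close> satisfies \<open>G(\<tau>) v = (w\<^sup>T v) x\<^sub>0\<close>, so it is a multiple of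
  \<open>x(\<tau>) = G(\<tau>)\<^sup>-\<^sup>1 x\<^sub>0\<close>. This vector is therefore itself an eigenvector, it is analytic by
  Cramer's rule, and \<open>w\<^sup>T x(\<tau>) = 1\<close>. Differentiating \<open>A x = \<lambda> x\<close> at \<open>\<tau>\<^sub>0\<close> and applying \<open>S\<close>
  yields \<open>x' = - S A' x\<^sub>0\<close>, where the term \<open>\<lambda>' x\<^sub>0\<close> drops out because \<open>S x\<^sub>0 = 0\<close>
  (\<open>analytic_right_eigenvector\<close>).

  The group inverse is compatible with transposition, so the same lemma applied to the transposed
  family yields an analytic left eigenvector \<open>z(\<tau>)\<^sup>T\<close> with \<open>z(\<tau>)\<^sup>T x\<^sub>0 = 1\<close>; the vector \<open>y\<close> is its
  conjugate. It remains to arrange \<open>z\<^sup>T x = 1\<close>. The function \<open>p = z\<^sup>T x\<close> has \<open>p(\<tau>\<^sub>0) = 1\<close> and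
  \<open>p'(\<tau>\<^sub>0) = (z\<^sup>T)' x\<^sub>0 + w\<^sup>T x' = 0\<close>, so replacing \<open>x\<close> by \<open>x / p\<close> achieves the normalization
  without changing the derivative at \<open>\<tau>\<^sub>0\<close>.\<close>

(* The dollar sign is reserved for entries of vectors whose dimension is not part of the type. *)
no_notation vec_nth (infixl "$" 90)

section \<open>Analytic vector and matrix functions\<close>

text \<open>Formats are only known eventually, so entries of a compound expression agree with the
  expected formula only near the point; this lemma and \<open>deriv_cong_ev\<close> pass from one to the
  other throughout this section.\<close>

lemma analytic_at_cong:
  assumes "f analytic_on {t}" "\<forall>\<^sub>F s in nhds t. f s = g s"
  shows "g analytic_on {t}"
proof -
  obtain U where U: "open U" "t \<in> U" "f holomorphic_on U"
    using assms(1) by (auto simp: analytic_at)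
  obtain V where V: "open V" "t \<in> V" "\<forall>s\<in>V. f s = g s"
    using assms(2) by (auto simp: eventually_nhds)
  have "f holomorphic_on U \<inter> V"
    using U(3) by (rule holomorphic_on_subset) auto
  then have "g holomorphic_on U \<inter> V"
    using V(3) by (elim holomorphic_transform) auto
  with U V show ?thesis
    unfolding analytic_at by (intro exI[of _ "U \<inter> V"]) auto
qed

lemma analytic_at_has_deriv:
  "f analytic_on {t} \<Longrightarrow> (f has_field_derivative deriv f t) (at t)"
  by (simp add: analytic_on_imp_differentiable_at field_differentiable_derivI)

lemma analytic_at_eventually_nonzero:
  assumes "f analytic_on {t}" "f t \<noteq> 0"
  shows "\<forall>\<^sub>F s in nhds t. f s \<noteq> 0"
  using analytic_at_neq_imp_eventually_neq[OF assms] assms(2) by (simp add: eventually_nhds_conv_at)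

lemma vec_analytic_atD:
  assumes "vec_analytic_at n v t"
  shows "\<forall>\<^sub>F s in nhds t. v s \<in> carrier_vec n" "v t \<in> carrier_vec n"
    "\<And>i. i < n \<Longrightarrow> (\<lambda>s. v s $ i) analytic_on {t}"
    "\<And>i. i < n \<Longrightarrow> ((\<lambda>s. v s $ i) has_field_derivative vec_deriv v t $ i) (at t)"
    "vec_deriv v t \<in> carrier_vec n"
proof -
  show ev: "\<forall>\<^sub>F s in nhds t. v s \<in> carrier_vec n"
    and an: "\<And>i. i < n \<Longrightarrow> (\<lambda>s. v s $ i) analytic_on {t}"
    using assms by (auto simp: vec_analytic_at_def)
  show t: "v t \<in> carrier_vec n"
    using eventually_nhds_x_imp_x[OF ev] .
  then show "vec_deriv v t \<in> carrier_vec n"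
    by (simp add: vec_deriv_def)
  show "((\<lambda>s. v s $ i) has_field_derivative vec_deriv v t $ i) (at t)" if "i < n" for i
    using analytic_at_has_deriv[OF an[OF that]] that t by (simp add: vec_deriv_def)
qed

lemma mat_analytic_atD:
  assumes "mat_analytic_at m n M t"
  shows "\<forall>\<^sub>F s in nhds t. M s \<in> carrier_mat m n" "M t \<in> carrier_mat m n"
    "\<And>i j. i < m \<Longrightarrow> j < n \<Longrightarrow> (\<lambda>s. M s $$ (i, j)) analytic_on {t}"
    "mat_deriv M t \<in> carrier_mat m n"
proof -
  show ev: "\<forall>\<^sub>F s in nhds t. M s \<in> carrier_mat m n"
    and an: "\<And>i j. i < m \<Longrightarrow> j < n \<Longrightarrow> (\<lambda>s. M s $$ (i, j)) analytic_on {t}"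
    using assms by (auto simp: mat_analytic_at_def)
  show t: "M t \<in> carrier_mat m n"
    using eventually_nhds_x_imp_x[OF ev] .
  then show "mat_deriv M t \<in> carrier_mat m n"
    by (simp add: mat_deriv_def)
qed

lemma vec_analytic_at_const: "v \<in> carrier_vec n \<Longrightarrow> vec_analytic_at n (\<lambda>_. v) t"
  by (simp add: vec_analytic_at_def)

lemma vec_deriv_const: "v \<in> carrier_vec n \<Longrightarrow> vec_deriv (\<lambda>_. v) t = 0\<^sub>v n"
  by (auto simp: vec_deriv_def)

lemma vec_deriv_cong:
  assumes "\<forall>\<^sub>F s in nhds t. u s = v s"
  shows "vec_deriv u t = vec_deriv v t"
proof -
  have "deriv (\<lambda>s. u s $ i) t = deriv (\<lambda>s. v s $ i) t" for i
    by (rule deriv_cong_ev[OF eventually_mono[OF assms]]) auto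
  then show ?thesis
    using eventually_nhds_x_imp_x[OF assms] by (simp add: vec_deriv_def)
qed

lemma analytic_at_scalar_prod:
  assumes u: "vec_analytic_at n u t" and v: "vec_analytic_at n v t"
  shows "(\<lambda>s. u s \<bullet> v s) analytic_on {t}"
    and "deriv (\<lambda>s. u s \<bullet> v s) t = vec_deriv u t \<bullet> v t + u t \<bullet> vec_deriv v t"
proof -
  note U = vec_analytic_atD[OF u] and V = vec_analytic_atD[OF v]
  have ev: "\<forall>\<^sub>F s in nhds t. (\<Sum>i = 0..<n. u s $ i * v s $ i) = u s \<bullet> v s"
    using V(1) by eventually_elim (auto simp: scalar_prod_def)
  show "(\<lambda>s. u s \<bullet> v s) analytic_on {t}"
    by (rule analytic_at_cong[OF _ ev]) (auto intro!: analytic_intros U V)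
  have "((\<lambda>s. \<Sum>i = 0..<n. u s $ i * v s $ i) has_field_derivative
      (\<Sum>i = 0..<n. vec_deriv u t $ i * v t $ i + vec_deriv v t $ i * u t $ i)) (at t)"
    by (intro DERIV_sum DERIV_mult U V) auto
  then have "deriv (\<lambda>s. \<Sum>i = 0..<n. u s $ i * v s $ i) t =
      (\<Sum>i = 0..<n. vec_deriv u t $ i * v t $ i + vec_deriv v t $ i * u t $ i)"
    by (rule DERIV_imp_deriv)
  also have "\<dots> = vec_deriv u t \<bullet> v t + u t \<bullet> vec_deriv v t"
    using U(5) V(2,5) by (simp add: scalar_prod_def sum.distrib mult.commute)
  finally show "deriv (\<lambda>s. u s \<bullet> v s) t = vec_deriv u t \<bullet> v t + u t \<bullet> vec_deriv v t"
    by (simp add: deriv_cong_ev[OF ev refl])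
qed

lemma row_analytic_at:
  assumes M: "mat_analytic_at m n M t" and i: "i < m"
  shows "vec_analytic_at n (\<lambda>s. row (M s) i) t"
    and "vec_deriv (\<lambda>s. row (M s) i) t = row (mat_deriv M t) i"
proof -
  note D = mat_analytic_atD[OF M]
  have ent: "\<forall>\<^sub>F s in nhds t. M s $$ (i, j) = row (M s) i $ j" if "j < n" for j
    using D(1) by eventually_elim (use i that in auto)
  have "\<forall>\<^sub>F s in nhds t. row (M s) i \<in> carrier_vec n"
    using D(1) by eventually_elim (use i in auto)
  then show "vec_analytic_at n (\<lambda>s. row (M s) i) t"
    unfolding vec_analytic_at_def
    using i by (auto intro: analytic_at_cong[OF D(3) ent])
  have "deriv (\<lambda>s. row (M s) i $ j) t = deriv (\<lambda>s. M s $$ (i, j)) t" if "j < n" for j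
    using deriv_cong_ev[OF ent[OF that] refl] by simp
  then show "vec_deriv (\<lambda>s. row (M s) i) t = row (mat_deriv M t) i"
    using D(2,4) i by (intro eq_vecI) (auto simp: vec_deriv_def mat_deriv_def)
qed

lemma vec_analytic_at_mult_mat_vec:
  assumes M: "mat_analytic_at m n M t" and v: "vec_analytic_at n v t"
  shows "vec_analytic_at m (\<lambda>s. M s *\<^sub>v v s) t"
    and "vec_deriv (\<lambda>s. M s *\<^sub>v v s) t = mat_deriv M t *\<^sub>v v t + M t *\<^sub>v vec_deriv v t"
proof -
  note D = mat_analytic_atD[OF M] and V = vec_analytic_atD[OF v]
  have ent: "\<forall>\<^sub>F s in nhds t. row (M s) i \<bullet> v s = (M s *\<^sub>v v s) $ i" if "i < m" for i
    using D(1) by eventually_elim (use that in auto)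
  have "\<forall>\<^sub>F s in nhds t. M s *\<^sub>v v s \<in> carrier_vec m"
    using D(1) by eventually_elim (rule carrier_vecI, simp)
  then show "vec_analytic_at m (\<lambda>s. M s *\<^sub>v v s) t"
    unfolding vec_analytic_at_def
    by (auto intro!: analytic_at_cong[OF _ ent] analytic_at_scalar_prod[OF row_analytic_at(1)[OF M] v])
  have "deriv (\<lambda>s. (M s *\<^sub>v v s) $ i) t = row (mat_deriv M t) i \<bullet> v t + row (M t) i \<bullet> vec_deriv v t"
    if "i < m" for i
    using deriv_cong_ev[OF ent[OF that] refl]
      analytic_at_scalar_prod(2)[OF row_analytic_at(1)[OF M that] v]
      row_analytic_at(2)[OF M that] by simp
  then show "vec_deriv (\<lambda>s. M s *\<^sub>v v s) t = mat_deriv M t *\<^sub>v v t + M t *\<^sub>v vec_deriv v t"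
    using D(2,4) V(5) by (intro eq_vecI) (auto simp: vec_deriv_def)
qed

lemma vec_analytic_at_smult:
  assumes f: "f analytic_on {t}" and v: "vec_analytic_at n v t"
  shows "vec_analytic_at n (\<lambda>s. f s \<cdot>\<^sub>v v s) t"
    and "vec_deriv (\<lambda>s. f s \<cdot>\<^sub>v v s) t = deriv f t \<cdot>\<^sub>v v t + f t \<cdot>\<^sub>v vec_deriv v t"
proof -
  note V = vec_analytic_atD[OF v]
  have ent: "\<forall>\<^sub>F s in nhds t. f s * v s $ i = (f s \<cdot>\<^sub>v v s) $ i" if "i < n" for i
    using V(1) by eventually_elim (use that in auto)
  have "\<forall>\<^sub>F s in nhds t. f s \<cdot>\<^sub>v v s \<in> carrier_vec n"
    using V(1) by eventually_elim auto
  then show "vec_analytic_at n (\<lambda>s. f s \<cdot>\<^sub>v v s) t"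
    unfolding vec_analytic_at_def
    by (auto intro!: analytic_at_cong[OF _ ent] analytic_intros f V)
  have "deriv (\<lambda>s. (f s \<cdot>\<^sub>v v s) $ i) t = deriv f t * v t $ i + f t * vec_deriv v t $ i"
    if "i < n" for i
  proof -
    have "deriv (\<lambda>s. (f s \<cdot>\<^sub>v v s) $ i) t = deriv (\<lambda>s. f s * v s $ i) t"
      using deriv_cong_ev[OF ent[OF that] refl] by simp
    also have "\<dots> = deriv f t * v t $ i + vec_deriv v t $ i * f t"
      by (intro DERIV_imp_deriv DERIV_mult analytic_at_has_deriv f V that)
    finally show ?thesis by (simp add: mult.commute)
  qed
  then show "vec_deriv (\<lambda>s. f s \<cdot>\<^sub>v v s) t = deriv f t \<cdot>\<^sub>v v t + f t \<cdot>\<^sub>v vec_deriv v t"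
    using V(2,5) by (intro eq_vecI) (auto simp: vec_deriv_def)
qed

lemma transpose_analytic_at:
  assumes M: "mat_analytic_at m n M t"
  shows "mat_analytic_at n m (\<lambda>s. transpose_mat (M s)) t"
    and "mat_deriv (\<lambda>s. transpose_mat (M s)) t = transpose_mat (mat_deriv M t)"
proof -
  note D = mat_analytic_atD[OF M]
  have ent: "\<forall>\<^sub>F s in nhds t. M s $$ (i, j) = transpose_mat (M s) $$ (j, i)"
    if "i < m" "j < n" for i j
    using D(1) by eventually_elim (use that in auto)
  have "\<forall>\<^sub>F s in nhds t. transpose_mat (M s) \<in> carrier_mat n m"
    using D(1) by eventually_elim auto
  then show "mat_analytic_at n m (\<lambda>s. transpose_mat (M s)) t"
    unfolding mat_analytic_at_def by (auto intro: analytic_at_cong[OF D(3) ent])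
  have "deriv (\<lambda>s. transpose_mat (M s) $$ (j, i)) t = deriv (\<lambda>s. M s $$ (i, j)) t"
    if "i < m" "j < n" for i j
    using deriv_cong_ev[OF ent[OF that] refl] by simp
  then show "mat_deriv (\<lambda>s. transpose_mat (M s)) t = transpose_mat (mat_deriv M t)"
    using D(2,4) by (intro eq_matI) (auto simp: mat_deriv_def)
qed

text \<open>By the Leibniz formula the determinant is a polynomial in the entries. Through the cofactors
  the same holds for the adjugate, which makes Cramer's rule an analytic way to solve linear
  systems.\<close>

lemma det_analytic_at:
  assumes "mat_analytic_at n n M t"
  shows "(\<lambda>s. det (M s)) analytic_on {t}"
proof (rule analytic_at_cong)
  note D = mat_analytic_atD[OF assms]
  show "(\<lambda>s. \<Sum>p | p permutes {0..<n}. signof p * (\<Prod>i = 0..<n. M s $$ (i, p i))) analytic_on {t}"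
    by (intro analytic_intros D) (auto simp: permutes_in_image)
  show "\<forall>\<^sub>F s in nhds t.
      (\<Sum>p | p permutes {0..<n}. signof p * (\<Prod>i = 0..<n. M s $$ (i, p i))) = det (M s)"
    using D(1) by eventually_elim (simp add: det_def')
qed

lemma mat_delete_analytic_at:
  assumes M: "mat_analytic_at m n M t"
  shows "mat_analytic_at (m - 1) (n - 1) (\<lambda>s. mat_delete (M s) k l) t"
  unfolding mat_analytic_at_def
proof (intro conjI allI impI)
  note D = mat_analytic_atD[OF M]
  show "\<forall>\<^sub>F s in nhds t. mat_delete (M s) k l \<in> carrier_mat (m - 1) (n - 1)"
    using D(1) by eventually_elim (rule mat_delete_carrier)
  fix i j assume ij: "i < m - 1" "j < n - 1"
  let ?i = "if i < k then i else Suc i" and ?j = "if j < l then j else Suc j"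
  have "(\<lambda>s. M s $$ (?i, ?j)) analytic_on {t}"
    using ij by (intro D) auto
  moreover have "\<forall>\<^sub>F s in nhds t. M s $$ (?i, ?j) = mat_delete (M s) k l $$ (i, j)"
    using D(1) by eventually_elim (use ij in \<open>auto simp: mat_delete_def\<close>)
  ultimately show "(\<lambda>s. mat_delete (M s) k l $$ (i, j)) analytic_on {t}"
    by (rule analytic_at_cong)
qed

lemma adj_mat_analytic_at:
  assumes M: "mat_analytic_at n n M t"
  shows "mat_analytic_at n n (\<lambda>s. adj_mat (M s)) t"
  unfolding mat_analytic_at_def
proof (intro conjI allI impI)
  note D = mat_analytic_atD[OF M]
  show "\<forall>\<^sub>F s in nhds t. adj_mat (M s) \<in> carrier_mat n n"
    using D(1) by eventually_elim (rule adj_mat)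
  fix i j assume ij: "i < n" "j < n"
  have "(\<lambda>s. (-1) ^ (j + i) * det (mat_delete (M s) j i)) analytic_on {t}"
    by (intro analytic_intros det_analytic_at[OF mat_delete_analytic_at[OF M]])
  moreover have "\<forall>\<^sub>F s in nhds t.
      (-1) ^ (j + i) * det (mat_delete (M s) j i) = adj_mat (M s) $$ (i, j)"
    using D(1) by eventually_elim (use ij in \<open>auto simp: adj_mat_def cofactor_def\<close>)
  ultimately show "(\<lambda>s. adj_mat (M s) $$ (i, j)) analytic_on {t}"
    by (rule analytic_at_cong)
qed

section \<open>The group inverse for a one-dimensional kernel\<close>

definition rank_one :: "'a :: times vec \<Rightarrow> 'a vec \<Rightarrow> 'a mat" where
  "rank_one x w = mat (dim_vec x) (dim_vec w) (\<lambda>(i, j). x $ i * w $ j)"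

lemma rank_one_carrier [simp]:
  "x \<in> carrier_vec m \<Longrightarrow> w \<in> carrier_vec n \<Longrightarrow> rank_one x w \<in> carrier_mat m n"
  by (simp add: rank_one_def)

lemma transpose_rank_one: "transpose_mat (rank_one x w) = rank_one w (x :: 'a :: comm_semiring_0 vec)"
  by (intro eq_matI) (auto simp: rank_one_def mult.commute)

lemma rank_one_mult_vec:
  fixes x :: "'a :: comm_semiring_0 vec"
  assumes "w \<in> carrier_vec n" "v \<in> carrier_vec n"
  shows "rank_one x w *\<^sub>v v = (w \<bullet> v) \<cdot>\<^sub>v x"
  using assms
  by (intro eq_vecI) (auto simp: rank_one_def scalar_prod_def sum_distrib_left ac_simps)

text \<open>With \<open>P = x w\<^sup>T\<close>, which is a projector because \<open>w\<^sup>T x = 1\<close>, the matrix \<open>S\<close> is the group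
  inverse of \<open>M\<close>: it inverts \<open>M\<close> on the range of \<open>1 - P\<close> and vanishes on the range of \<open>P\<close>.
  For \<open>M = A\<^sub>0 - \<lambda>\<^sub>0\<close> this is the reduced resolvent at a simple eigenvalue. The vectors \<open>x\<close> and
  \<open>w\<close> span the right and the left kernel of \<open>M\<close>. Plain transposes are used, so that no
  conjugation disturbs analyticity, and all conditions are listed in pairs, so that the notion is
  visibly invariant under transposition.\<close>

definition simple_group_inverse ::
    "nat \<Rightarrow> complex mat \<Rightarrow> complex vec \<Rightarrow> complex vec \<Rightarrow> complex mat \<Rightarrow> bool" where
  "simple_group_inverse n M x w S \<longleftrightarrow>
     M \<in> carrier_mat n n \<and> S \<in> carrier_mat n n \<and> x \<in> carrier_vec n \<and> w \<in> carrier_vec n \<and>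
     w \<bullet> x = 1 \<and>
     M * rank_one x w = 0\<^sub>m n n \<and> rank_one x w * M = 0\<^sub>m n n \<and>
     S * rank_one x w = 0\<^sub>m n n \<and> rank_one x w * S = 0\<^sub>m n n \<and>
     S * M = 1\<^sub>m n - rank_one x w \<and> M * S = 1\<^sub>m n - rank_one x w"

text \<open>This symmetry reduces every statement about left eigenvectors to one about right
  eigenvectors of the transposed matrix.\<close>

lemma simple_group_inverse_transpose:
  assumes "simple_group_inverse n M x w S"
  shows "simple_group_inverse n (transpose_mat M) w x (transpose_mat S)"
proof -
  note a = assms[unfolded simple_group_inverse_def]
  have P: "rank_one x w \<in> carrier_mat n n" using a by simp
  have *: "transpose_mat B * transpose_mat C = transpose_mat D"
    if "B \<in> carrier_mat n n" "C \<in> carrier_mat n n" "C * B = D" for B C D :: "complex mat"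
    using that by (auto simp: transpose_mult)
  have D: "transpose_mat (1\<^sub>m n - rank_one x w) = 1\<^sub>m n - rank_one w x"
    using P by (simp add: transpose_minus[of _ n n] transpose_rank_one)
  have "x \<bullet> w = 1"
    using a comm_scalar_prod by metis
  moreover have "transpose_mat M * rank_one w x = 0\<^sub>m n n"
    "rank_one w x * transpose_mat M = 0\<^sub>m n n"
    "transpose_mat S * rank_one w x = 0\<^sub>m n n"
    "rank_one w x * transpose_mat S = 0\<^sub>m n n"
    "transpose_mat S * transpose_mat M = 1\<^sub>m n - rank_one w x"
    "transpose_mat M * transpose_mat S = 1\<^sub>m n - rank_one w x"
    using a P *[of M "rank_one x w"] *[of "rank_one x w" M] *[of S "rank_one x w"]
      *[of "rank_one x w" S] *[of S M] *[of M S]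
    by (simp_all add: transpose_rank_one D)
  ultimately show ?thesis
    using a by (simp add: simple_group_inverse_def)
qed

lemma simple_group_inverseD:
  assumes "simple_group_inverse n M x w S"
  shows "M *\<^sub>v x = 0\<^sub>v n" "S *\<^sub>v x = 0\<^sub>v n"
    "\<And>v. v \<in> carrier_vec n \<Longrightarrow> S *\<^sub>v (M *\<^sub>v v) = v - (w \<bullet> v) \<cdot>\<^sub>v x"
proof -
  note a = assms[unfolded simple_group_inverse_def]
  have P: "rank_one x w \<in> carrier_mat n n" using a by simp
  have Px: "rank_one x w *\<^sub>v x = x"
    using a rank_one_mult_vec[of w n x x] by simp
  have kill: "B *\<^sub>v x = 0\<^sub>v n" if "B \<in> carrier_mat n n" "B * rank_one x w = 0\<^sub>m n n" for B
  proof -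
    have "B *\<^sub>v x = (B * rank_one x w) *\<^sub>v x"
      using assoc_mult_mat_vec[OF that(1) P, of x] a Px by simp
    also have "\<dots> = 0\<^sub>v n"
      unfolding that(2) using a by (intro eq_vecI) auto
    finally show ?thesis .
  qed
  show "M *\<^sub>v x = 0\<^sub>v n" "S *\<^sub>v x = 0\<^sub>v n"
    using a kill by auto
  fix v :: "complex vec" assume v: "v \<in> carrier_vec n"
  have "S *\<^sub>v (M *\<^sub>v v) = (1\<^sub>m n - rank_one x w) *\<^sub>v v"
    using assoc_mult_mat_vec[of S n n M n v] a v by simp
  also have "\<dots> = v - (w \<bullet> v) \<cdot>\<^sub>v x"
    using minus_mult_distrib_mat_vec[OF one_carrier_mat P v] rank_one_mult_vec[of w n v x] a v by simp
  finally show "S *\<^sub>v (M *\<^sub>v v) = v - (w \<bullet> v) \<cdot>\<^sub>v x" .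
qed

text \<open>If \<open>M v + (w\<^sup>T v) x = 0\<close>, then applying \<open>S\<close> gives \<open>v = (w\<^sup>T v) x\<close>, so \<open>M v = 0\<close>, and hence
  \<open>(w\<^sup>T v) x = 0\<close>, that is \<open>v = 0\<close>: adding the spectral projector removes the kernel of \<open>M\<close>.\<close>

lemma det_bordered_nonzero:
  assumes sp: "simple_group_inverse n M x w S"
  shows "det (M + rank_one x w) \<noteq> 0"
proof
  note a = sp[unfolded simple_group_inverse_def] and d = simple_group_inverseD[OF sp]
  have P: "rank_one x w \<in> carrier_mat n n" using a by simp
  assume "det (M + rank_one x w) = 0"
  then obtain v where v: "v \<in> carrier_vec n" "v \<noteq> 0\<^sub>v n" "(M + rank_one x w) *\<^sub>v v = 0\<^sub>v n"
    using a P det_0_iff_vec_prod_zero[of "M + rank_one x w" n] by auto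
  have eq: "M *\<^sub>v v + (w \<bullet> v) \<cdot>\<^sub>v x = 0\<^sub>v n"
    using v a add_mult_distrib_mat_vec[of M n n "rank_one x w" v]
      rank_one_mult_vec[of w n v x] by simp
  have "0\<^sub>v n = S *\<^sub>v (M *\<^sub>v v + (w \<bullet> v) \<cdot>\<^sub>v x)"
    unfolding eq using a by (intro eq_vecI) auto
  also have "\<dots> = S *\<^sub>v (M *\<^sub>v v) + (w \<bullet> v) \<cdot>\<^sub>v (S *\<^sub>v x)"
    using a mult_mat_vec_carrier[of M n n v] v(1)
      mult_add_distrib_mat_vec[of S n n "M *\<^sub>v v" "(w \<bullet> v) \<cdot>\<^sub>v x"]
    by (simp add: mult_mat_vec[of S n n])
  also have "\<dots> = v - (w \<bullet> v) \<cdot>\<^sub>v x"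
    unfolding d(2) d(3)[OF v(1)] using v a by (intro eq_vecI) auto
  finally have vx: "v = (w \<bullet> v) \<cdot>\<^sub>v x"
    using v(1) a by (auto simp: vec_eq_iff)
  then have "M *\<^sub>v v = (w \<bullet> v) \<cdot>\<^sub>v (M *\<^sub>v x)"
    using mult_mat_vec[of M n n x "w \<bullet> v"] a by metis
  then have "M *\<^sub>v v = 0\<^sub>v n"
    unfolding d(1) by (auto simp: vec_eq_iff)
  with eq a v have "(w \<bullet> v) \<cdot>\<^sub>v x = 0\<^sub>v n" by simp
  with vx v show False by metis
qed

section \<open>An analytic right eigenvector\<close>

lemma shifted_mult_vec:
  fixes B :: "'a :: comm_ring_1 mat"
  assumes "B \<in> carrier_mat n n" "v \<in> carrier_vec n"
  shows "(B - c \<cdot>\<^sub>m 1\<^sub>m n) *\<^sub>v v = B *\<^sub>v v - c \<cdot>\<^sub>v v"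
proof -
  have "(c \<cdot>\<^sub>m 1\<^sub>m n) *\<^sub>v v = c \<cdot>\<^sub>v v"
    using assms by (intro eq_vecI) (auto simp: scalar_prod_def if_distrib if_distribR cong: if_cong)
  then show ?thesis
    using assms by (simp add: minus_mult_distrib_mat_vec[of _ n n])
qed

text \<open>An eigenvector \<open>v\<close> of \<open>B\<close> for \<open>c\<close> satisfies \<open>G v = (w\<^sup>T v) x\<close>, because \<open>B - c\<close> annihilates it.
  As \<open>G\<close> is invertible, \<open>w\<^sup>T v\<close> cannot vanish, so \<open>v / (w\<^sup>T v)\<close> is the vector
  \<open>u = G\<^sup>-\<^sup>1 x\<close>, written here by Cramer's rule. An eigenvector that is only known to exist is
  thus replaced by one that depends on \<open>B\<close> and \<open>c\<close> through an explicit formula.\<close>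

lemma bordered_solution_is_eigenvector:
  fixes B :: "complex mat"
  assumes B: "B \<in> carrier_mat n n" and x: "x \<in> carrier_vec n" and w: "w \<in> carrier_vec n"
    and ev: "eigenvalue B c"
    and G: "G = B - c \<cdot>\<^sub>m 1\<^sub>m n + rank_one x w" and det: "det G \<noteq> 0"
    and u: "u = inverse (det G) \<cdot>\<^sub>v (adj_mat G *\<^sub>v x)"
  shows "B *\<^sub>v u = c \<cdot>\<^sub>v u" and "w \<bullet> u = 1"
proof -
  have P: "rank_one x w \<in> carrier_mat n n" using x w by simp
  have Gc: "G \<in> carrier_mat n n" using B P G by simp
  note adj = adj_mat[OF Gc]
  obtain v where v: "v \<in> carrier_vec n" "v \<noteq> 0\<^sub>v n" "B *\<^sub>v v = c \<cdot>\<^sub>v v"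
    using ev B by (auto simp: eigenvalue_def eigenvector_def)
  have uc: "u \<in> carrier_vec n" using u adj x by simp
  have "G *\<^sub>v v = (B - c \<cdot>\<^sub>m 1\<^sub>m n) *\<^sub>v v + rank_one x w *\<^sub>v v"
    unfolding G using B P v by (intro add_mult_distrib_mat_vec) auto
  also have "\<dots> = (w \<bullet> v) \<cdot>\<^sub>v x"
    using B v w x by (simp add: shifted_mult_vec rank_one_mult_vec)
  finally have Gv: "G *\<^sub>v v = (w \<bullet> v) \<cdot>\<^sub>v x" .
  have "det G \<cdot>\<^sub>v v = (adj_mat G * G) *\<^sub>v v"
    unfolding adj using v by (intro eq_vecI)
      (auto simp: scalar_prod_def if_distrib if_distribR cong: if_cong)
  also have "\<dots> = adj_mat G *\<^sub>v (G *\<^sub>v v)"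
    by (rule assoc_mult_mat_vec[OF adj(1) Gc v(1)])
  also have "\<dots> = (w \<bullet> v) \<cdot>\<^sub>v (adj_mat G *\<^sub>v x)"
    unfolding Gv using adj(1) x by (rule mult_mat_vec)
  finally have "inverse (det G) \<cdot>\<^sub>v (det G \<cdot>\<^sub>v v) =
      inverse (det G) \<cdot>\<^sub>v ((w \<bullet> v) \<cdot>\<^sub>v (adj_mat G *\<^sub>v x))" by simp
  then have vu: "v = (w \<bullet> v) \<cdot>\<^sub>v u"
    using det by (simp add: u smult_smult_assoc mult.commute)
  have "0 \<cdot>\<^sub>v u = 0\<^sub>v n"
    using uc by (intro eq_vecI) auto
  then have wv: "w \<bullet> v \<noteq> 0"
    using v(2) vu by metis
  have "(w \<bullet> v) * (w \<bullet> u) = w \<bullet> v"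
    using scalar_prod_smult_distrib[OF w uc, of "w \<bullet> v"] vu by metis
  then show "w \<bullet> u = 1" using wv by simp
  have uv: "u = inverse (w \<bullet> v) \<cdot>\<^sub>v v"
  proof -
    have "u = inverse (w \<bullet> v) \<cdot>\<^sub>v ((w \<bullet> v) \<cdot>\<^sub>v u)"
      using wv by (simp add: smult_smult_assoc)
    then show ?thesis using vu by metis
  qed
  show "B *\<^sub>v u = c \<cdot>\<^sub>v u"
    unfolding uv mult_mat_vec[OF B v(1)] v(3) by (simp add: smult_smult_assoc mult.commute)
qed

lemma bordered_analytic_at:
  assumes A: "mat_analytic_at n n A t" and lam: "lam analytic_on {t}"
    and x: "x \<in> carrier_vec n" and w: "w \<in> carrier_vec n"
  shows "mat_analytic_at n n (\<lambda>s. A s - lam s \<cdot>\<^sub>m 1\<^sub>m n + rank_one x w) t"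
  unfolding mat_analytic_at_def
proof (intro conjI allI impI)
  note D = mat_analytic_atD[OF A]
  show "\<forall>\<^sub>F s in nhds t. A s - lam s \<cdot>\<^sub>m 1\<^sub>m n + rank_one x w \<in> carrier_mat n n"
    using D(1) by eventually_elim (use x w in simp)
  fix i j assume ij: "i < n" "j < n"
  have "(\<lambda>s. A s $$ (i, j) - lam s * (1\<^sub>m n $$ (i, j)) + x $ i * w $ j) analytic_on {t}"
    by (intro analytic_intros D lam ij)
  moreover have "\<forall>\<^sub>F s in nhds t. A s $$ (i, j) - lam s * (1\<^sub>m n $$ (i, j)) + x $ i * w $ j =
      (A s - lam s \<cdot>\<^sub>m 1\<^sub>m n + rank_one x w) $$ (i, j)"
    using D(1) by eventually_elim (use ij x w in \<open>auto simp: rank_one_def\<close>)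
  ultimately show "(\<lambda>s. (A s - lam s \<cdot>\<^sub>m 1\<^sub>m n + rank_one x w) $$ (i, j)) analytic_on {t}"
    by (rule analytic_at_cong)
qed

text \<open>The eigenvector is \<open>x(s) = G(s)\<^sup>-\<^sup>1 x\<^sub>0\<close> with \<open>G = A - lam + x\<^sub>0 w\<^sup>T\<close>, analytic at \<open>t\<close>
  because \<open>det G(t) \<noteq> 0\<close>. It comes with the linear normalization \<open>w\<^sup>T x(s) = 1\<close>, whence \<open>w\<^sup>T x'(t) = 0\<close>.
  Differentiating \<open>A x = lam x\<close> gives \<open>(A(t) - lam(t)) x'(t) = lam'(t) x\<^sub>0 - A'(t) x\<^sub>0\<close>. Under \<open>S\<close> the
  left-hand side becomes \<open>x'(t)\<close>, and the unknown term with \<open>lam'(t)\<close> disappears since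
  \<open>S x\<^sub>0 = 0\<close>.\<close>

lemma analytic_right_eigenvector:
  assumes A: "mat_analytic_at n n A t" and lam: "lam analytic_on {t}"
    and ev: "\<forall>\<^sub>F s in nhds t. eigenvalue (A s) (lam s)"
    and sp: "simple_group_inverse n (A t - lam t \<cdot>\<^sub>m 1\<^sub>m n) x0 w S"
  obtains x where "vec_analytic_at n x t" "x t = x0"
    "\<forall>\<^sub>F s in nhds t. A s *\<^sub>v x s = lam s \<cdot>\<^sub>v x s"
    "w \<bullet> vec_deriv x t = 0"
    "vec_deriv x t = - (S * mat_deriv A t *\<^sub>v x0)"
proof
  note a = sp[unfolded simple_group_inverse_def] and d = simple_group_inverseD[OF sp]
  note D = mat_analytic_atD[OF A]
  have x0: "x0 \<in> carrier_vec n" and w: "w \<in> carrier_vec n" and S: "S \<in> carrier_mat n n"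
    using a by auto
  define G where "G s = A s - lam s \<cdot>\<^sub>m 1\<^sub>m n + rank_one x0 w" for s
  define x where "x s = inverse (det (G s)) \<cdot>\<^sub>v (adj_mat (G s) *\<^sub>v x0)" for s
  have G: "mat_analytic_at n n G t"
    unfolding G_def by (rule bordered_analytic_at[OF A lam x0 w])
  have det0: "det (G t) \<noteq> 0"
    unfolding G_def by (rule det_bordered_nonzero[OF sp])
  have "(\<lambda>s. inverse (det (G s))) analytic_on {t}"
    using det0 by (intro analytic_on_inverse det_analytic_at[OF G]) auto
  then show an: "vec_analytic_at n x t"
    unfolding x_def
    by (rule vec_analytic_at_smult(1)[OF _ vec_analytic_at_mult_mat_vec(1)[OF
          adj_mat_analytic_at[OF G] vec_analytic_at_const[OF x0]]])
  note X = vec_analytic_atD[OF an]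
  have "\<forall>\<^sub>F s in nhds t. det (G s) \<noteq> 0"
    by (rule analytic_at_eventually_nonzero[OF det_analytic_at[OF G] det0])
  then have both: "\<forall>\<^sub>F s in nhds t. A s *\<^sub>v x s = lam s \<cdot>\<^sub>v x s \<and> w \<bullet> x s = 1"
    using D(1) ev
  proof eventually_elim
    case (elim s)
    then show ?case
      using bordered_solution_is_eigenvector[OF elim(2) x0 w elim(3) G_def elim(1) x_def] by blast
  qed
  then show eq: "\<forall>\<^sub>F s in nhds t. A s *\<^sub>v x s = lam s \<cdot>\<^sub>v x s"
    by (rule eventually_mono) blast
  have norm: "\<forall>\<^sub>F s in nhds t. w \<bullet> x s = 1"
    using both by (rule eventually_mono) blast
  \<comment> \<open>The kernel is spanned by \<open>x0\<close>; the normalization fixes the multiple.\<close>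
  have "(A t - lam t \<cdot>\<^sub>m 1\<^sub>m n) *\<^sub>v x t = 0\<^sub>v n"
    using eventually_nhds_x_imp_x[OF eq] D(2) X(2) by (simp add: shifted_mult_vec)
  moreover have "S *\<^sub>v 0\<^sub>v n = 0\<^sub>v n"
    using S by (intro eq_vecI) auto
  ultimately have "0\<^sub>v n = x t - x0"
    using d(3)[OF X(2)] eventually_nhds_x_imp_x[OF norm] by simp
  then show xt: "x t = x0"
    using X(2) x0 by (auto simp: vec_eq_iff)
  have "deriv (\<lambda>s. w \<bullet> x s) t = 0"
    using deriv_cong_ev[OF norm refl] by simp
  then show wx': "w \<bullet> vec_deriv x t = 0"
    using analytic_at_scalar_prod(2)[OF vec_analytic_at_const[OF w] an] X w
    by (simp add: vec_deriv_const[OF w])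
  let ?A' = "mat_deriv A t" and ?x' = "vec_deriv x t"
  have eq': "?A' *\<^sub>v x0 + A t *\<^sub>v ?x' = deriv lam t \<cdot>\<^sub>v x0 + lam t \<cdot>\<^sub>v ?x'"
    using vec_deriv_cong[OF eq] vec_analytic_at_mult_mat_vec(2)[OF A an]
      vec_analytic_at_smult(2)[OF lam an] xt by simp
  have "(A t - lam t \<cdot>\<^sub>m 1\<^sub>m n) *\<^sub>v ?x' = A t *\<^sub>v ?x' - lam t \<cdot>\<^sub>v ?x'"
    by (rule shifted_mult_vec[OF D(2) X(5)])
  also have "\<dots> = deriv lam t \<cdot>\<^sub>v x0 - ?A' *\<^sub>v x0"
  proof (rule eq_vecI)
    fix i assume "i < dim_vec (deriv lam t \<cdot>\<^sub>v x0 - ?A' *\<^sub>v x0)"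
    then have "i < n" using D by simp
    then show "(A t *\<^sub>v ?x' - lam t \<cdot>\<^sub>v ?x') $ i = (deriv lam t \<cdot>\<^sub>v x0 - ?A' *\<^sub>v x0) $ i"
      using arg_cong[OF eq', of "\<lambda>v. v $ i"] D X x0 by (simp add: algebra_simps)
  qed (use D X in auto)
  finally have Mx': "(A t - lam t \<cdot>\<^sub>m 1\<^sub>m n) *\<^sub>v ?x' = deriv lam t \<cdot>\<^sub>v x0 - ?A' *\<^sub>v x0" .
  have "?x' = S *\<^sub>v ((A t - lam t \<cdot>\<^sub>m 1\<^sub>m n) *\<^sub>v ?x')"
    unfolding d(3)[OF X(5)] wx' using X(5) x0 by (intro eq_vecI) auto
  also have "\<dots> = deriv lam t \<cdot>\<^sub>v (S *\<^sub>v x0) - S *\<^sub>v (?A' *\<^sub>v x0)"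
    unfolding Mx' using S D x0
    by (simp add: mult_minus_distrib_mat_vec[of _ n n] mult_mat_vec[of _ n n])
  also have "\<dots> = - (S * ?A' *\<^sub>v x0)"
    unfolding d(2) assoc_mult_mat_vec[OF S D(4) x0] using S by (intro eq_vecI) auto
  finally show "?x' = - (S * ?A' *\<^sub>v x0)" .
qed

section \<open>The group inverse from a block diagonalization\<close>

definition block_diag :: "nat \<Rightarrow> 'a :: comm_ring_1 \<Rightarrow> 'a mat \<Rightarrow> 'a mat" where
  "block_diag m a E = four_block_mat (a \<cdot>\<^sub>m 1\<^sub>m 1) (0\<^sub>m 1 m) (0\<^sub>m m 1) E"

lemma block_diag_carrier [simp]:
  "E \<in> carrier_mat m m \<Longrightarrow> block_diag m a E \<in> carrier_mat (Suc m) (Suc m)"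
  unfolding block_diag_def by (rule carrier_matI) auto

lemma block_diag_mult:
  assumes "E \<in> carrier_mat m m" "E' \<in> carrier_mat m m"
  shows "block_diag m a E * block_diag m b E' = block_diag m (a * b) (E * E')"
proof -
  have "a \<cdot>\<^sub>m 1\<^sub>m 1 * (b \<cdot>\<^sub>m 1\<^sub>m 1) = (a * b) \<cdot>\<^sub>m (1\<^sub>m 1 :: 'a mat)"
    by (intro eq_matI) (auto simp: scalar_prod_def)
  then show ?thesis
    unfolding block_diag_def using assms
    by (subst mult_four_block_mat[of _ 1 1 _ m _ m _ _ 1 _ m]) auto
qed

lemma block_diag_one: "block_diag m 1 (1\<^sub>m m) = 1\<^sub>m (Suc m)"
  unfolding block_diag_def by (intro eq_matI) auto

lemma block_diag_zero: "block_diag m 0 (0\<^sub>m m m) = 0\<^sub>m (Suc m) (Suc m)"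
  unfolding block_diag_def by (intro eq_matI) auto

lemma block_diag_shift:
  assumes "E \<in> carrier_mat m m"
  shows "block_diag m a E - c \<cdot>\<^sub>m 1\<^sub>m (Suc m) = block_diag m (a - c) (E - c \<cdot>\<^sub>m 1\<^sub>m m)"
  using assms unfolding block_diag_def by (intro eq_matI) auto

lemma cons_cols_mult_block_diag:
  fixes x :: "'a :: comm_ring_1 vec"
  assumes x: "x \<in> carrier_vec n" and X1: "X1 \<in> carrier_mat n m" and E: "E \<in> carrier_mat m m"
  shows "mat_of_cols n (x # cols X1) * block_diag m a E = mat_of_cols n ((a \<cdot>\<^sub>v x) # cols (X1 * E))"
proof (rule eq_matI)
  fix i k
  assume "i < dim_row (mat_of_cols n ((a \<cdot>\<^sub>v x) # cols (X1 * E)))"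
    and "k < dim_col (mat_of_cols n ((a \<cdot>\<^sub>v x) # cols (X1 * E)))"
  then have ik: "i < n" "k < Suc m" using E by auto
  show "(mat_of_cols n (x # cols X1) * block_diag m a E) $$ (i, k) =
      mat_of_cols n ((a \<cdot>\<^sub>v x) # cols (X1 * E)) $$ (i, k)"
    using assms ik
    by (cases k) (auto simp: block_diag_def scalar_prod_def mat_of_cols_index sum.atLeast0_lessThan_Suc_shift
        simp del: sum.op_ivl_Suc)
qed (use E X1 in \<open>auto simp: block_diag_def\<close>)

lemma cons_cols_mult_cons_rows:
  fixes x :: "'a :: comm_ring_1 vec"
  assumes x: "x \<in> carrier_vec n" and U: "U \<in> carrier_mat n m"
    and w: "w \<in> carrier_vec n" and W: "W \<in> carrier_mat m n"
  shows "mat_of_cols n (x # cols U) * mat_of_rows n (w # rows W) = rank_one x w + U * W"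
proof (rule eq_matI)
  fix i j
  assume "i < dim_row (rank_one x w + U * W)" "j < dim_col (rank_one x w + U * W)"
  then have ij: "i < n" "j < n" using U W by auto
  show "(mat_of_cols n (x # cols U) * mat_of_rows n (w # rows W)) $$ (i, j) =
      (rank_one x w + U * W) $$ (i, j)"
    using assms ij
    by (auto simp: rank_one_def scalar_prod_def mat_of_cols_index mat_of_rows_index
        sum.atLeast0_lessThan_Suc_shift simp del: sum.op_ivl_Suc)
qed (use U W in auto)

lemma mat_adjoint_cons_cols:
  assumes "y \<in> carrier_vec n" "Y1 \<in> carrier_mat n m"
  shows "mat_adjoint (mat_of_cols n (y # cols Y1)) =
    mat_of_rows n (conjugate y # rows (mat_adjoint Y1))"
proof (rule eq_matI)
  fix i j
  assume "i < dim_row (mat_of_rows n (conjugate y # rows (mat_adjoint Y1)))"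
    and "j < dim_col (mat_of_rows n (conjugate y # rows (mat_adjoint Y1)))"
  then have ij: "i < Suc m" "j < n" using assms by (auto simp: mat_adjoint_def)
  show "mat_adjoint (mat_of_cols n (y # cols Y1)) $$ (i, j) =
      mat_of_rows n (conjugate y # rows (mat_adjoint Y1)) $$ (i, j)"
    using assms ij
    by (cases i) (auto simp: mat_adjoint_def mat_of_rows_index mat_of_cols_index)
qed (use assms in \<open>auto simp: mat_adjoint_def\<close>)

text \<open>All matrices involved have the form \<open>F a E = X diag(a, E) Z\<close>: the shifted matrix is
  \<open>F 0 (B\<^sub>1 - c)\<close>, its group inverse is \<open>F 0 K\<close>, the projector is \<open>F 1 0\<close> and its complement is \<open>F 0 1\<close>.
  Since \<open>Z X = 1\<close>, the map \<open>F\<close> is multiplicative in both arguments, so every identity of a group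
  inverse is read off from the blocks.\<close>

lemma group_inverse_of_block_diagonal:
  assumes x: "x \<in> carrier_vec (Suc m)" and X1: "X1 \<in> carrier_mat (Suc m) m"
    and w: "w \<in> carrier_vec (Suc m)" and W1: "W1 \<in> carrier_mat m (Suc m)"
    and A0: "A0 \<in> carrier_mat (Suc m) (Suc m)"
    and B1: "B1 \<in> carrier_mat m m" and K: "K \<in> carrier_mat m m"
    and wx: "w \<bullet> x = 1"
    and X: "X = mat_of_cols (Suc m) (x # cols X1)" and Z: "Z = mat_of_rows (Suc m) (w # rows W1)"
    and ZX: "Z * X = 1\<^sub>m (Suc m)" and ZAX: "Z * A0 * X = block_diag m c B1"
    and inv: "(B1 - c \<cdot>\<^sub>m 1\<^sub>m m) * K = 1\<^sub>m m" "K * (B1 - c \<cdot>\<^sub>m 1\<^sub>m m) = 1\<^sub>m m"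
  shows "simple_group_inverse (Suc m) (A0 - c \<cdot>\<^sub>m 1\<^sub>m (Suc m)) x w (X1 * K * W1)"
proof -
  let ?n = "Suc m"
  define F where "F a E = X * block_diag m a E * Z" for a E
  have Xc: "X \<in> carrier_mat ?n ?n" and Zc: "Z \<in> carrier_mat ?n ?n"
    using X1 W1 by (auto simp: X Z)
  have XZ: "X * Z = 1\<^sub>m ?n"
    by (rule mat_mult_left_right_inverse[OF Zc Xc ZX])
  have P: "rank_one x w \<in> carrier_mat ?n ?n" using x w by simp
  have Bc: "B1 - c \<cdot>\<^sub>m 1\<^sub>m m \<in> carrier_mat m m" by (intro minus_carrier_mat) simp
  have F_mult: "F a E * F b E' = F (a * b) (E * E')"
    if E: "E \<in> carrier_mat m m" "E' \<in> carrier_mat m m" for a b E E'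
  proof -
    note D = block_diag_carrier[OF E(1), of a] block_diag_carrier[OF E(2), of b]
    have "F a E * F b E' = X * block_diag m a E * (Z * X) * (block_diag m b E' * Z)"
      unfolding F_def using Xc Zc D
      by (simp add: assoc_mult_mat[of _ ?n ?n _ ?n _ ?n])
    also have "\<dots> = X * (block_diag m a E * block_diag m b E') * Z"
      unfolding ZX using Xc Zc D by (simp add: assoc_mult_mat[of _ ?n ?n _ ?n _ ?n])
    finally show ?thesis
      using E by (simp add: F_def block_diag_mult)
  qed
  have F_split: "F a E = rank_one (a \<cdot>\<^sub>v x) w + X1 * E * W1" if "E \<in> carrier_mat m m" for a E
    unfolding F_def X Z cons_cols_mult_block_diag[OF x X1 that]
    by (rule cons_cols_mult_cons_rows[OF _ mult_carrier_mat[OF X1 that] w W1]) (use x in simp)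
  have one: "1\<^sub>m ?n = F 1 (1\<^sub>m m)"
    using Xc XZ by (simp add: F_def block_diag_one)
  have zero: "0\<^sub>m ?n ?n = F 0 (0\<^sub>m m m)"
    using Xc Zc by (simp add: F_def block_diag_zero)
  have z: "rank_one (0 \<cdot>\<^sub>v x) w = 0\<^sub>m ?n ?n"
    using x w by (intro eq_matI) (auto simp: rank_one_def)
  have PF: "rank_one x w = F 1 (0\<^sub>m m m)"
    using F_split[of "0\<^sub>m m m" 1] P X1 W1 by simp
  have SF: "X1 * K * W1 = F 0 K"
    using F_split[OF K, of 0] X1 W1 K by (simp add: z)
  \<comment> \<open>Comparing \<open>F 1 1\<close> with \<open>F 0 1\<close>: they differ exactly by the projector.\<close>
  have QF: "1\<^sub>m ?n - rank_one x w = F 0 (1\<^sub>m m)"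
  proof -
    have "1\<^sub>m ?n = rank_one x w + X1 * W1"
      using one F_split[of "1\<^sub>m m" 1] X1 by simp
    moreover have "F 0 (1\<^sub>m m) = X1 * W1"
      using F_split[of "1\<^sub>m m" 0] X1 W1 by (simp add: z)
    ultimately show ?thesis
      using P X1 W1 by (intro eq_matI) auto
  qed
  have "X * (Z * A0 * X) * Z = (X * Z) * A0 * (X * Z)"
    using Xc Zc A0 by (simp add: assoc_mult_mat[of _ ?n ?n _ ?n _ ?n])
  then have A0F: "A0 = F c B1"
    using A0 by (simp add: F_def ZAX XZ)
  have MF: "A0 - c \<cdot>\<^sub>m 1\<^sub>m ?n = F 0 (B1 - c \<cdot>\<^sub>m 1\<^sub>m m)"
  proof -
    note D = block_diag_carrier[OF B1, of c]
    have "F 0 (B1 - c \<cdot>\<^sub>m 1\<^sub>m m) = X * (block_diag m c B1 - c \<cdot>\<^sub>m 1\<^sub>m ?n) * Z"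
      using block_diag_shift[OF B1, of c c] by (simp add: F_def)
    also have "\<dots> = (X * block_diag m c B1 - c \<cdot>\<^sub>m X) * Z"
      using Xc D by (simp add: mult_minus_distrib_mat[of _ ?n ?n] mult_smult_distrib[of _ ?n ?n _ ?n])
    also have "\<dots> = F c B1 - c \<cdot>\<^sub>m (X * Z)"
      using Xc D Zc mult_smult_assoc_mat[of X ?n ?n Z ?n c]
      by (simp add: F_def minus_mult_distrib_mat[of _ ?n ?n])
    finally show ?thesis by (simp add: A0F XZ)
  qed
  have c: "F 0 K \<in> carrier_mat ?n ?n" "F 0 (B1 - c \<cdot>\<^sub>m 1\<^sub>m m) \<in> carrier_mat ?n ?n"
    using Xc Zc K Bc by (auto simp: F_def)
  show ?thesis
    unfolding simple_group_inverse_def SF MF QF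
    using x w wx c K Bc
    by (simp add: PF F_mult zero inv)
qed

text \<open>The characteristic polynomial of \<open>A0\<close> is \<open>X - c\<close> times that of \<open>B1\<close>. A simple root \<open>c\<close> is
  used up by the first factor, so \<open>c\<close> is not an eigenvalue of \<open>B1\<close>.\<close>

lemma simple_eigenvalue_deflated_invertible:
  assumes B1: "B1 \<in> carrier_mat m m"
    and simple: "simple_eigenvalue A0 c" and cp: "similar_mat A0 (block_diag m c B1)"
  shows "\<exists>K. mat_inverse (B1 - c \<cdot>\<^sub>m 1\<^sub>m m) = Some K"
proof -
  have one: "c \<cdot>\<^sub>m 1\<^sub>m 1 \<in> carrier_mat 1 1" by simp
  have "char_poly A0 = char_poly (c \<cdot>\<^sub>m 1\<^sub>m 1) * char_poly B1"
    unfolding char_poly_similar[OF cp] block_diag_def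
    by (rule char_poly_four_block_zeros_col[OF one _ B1]) simp
  moreover have "char_poly (c \<cdot>\<^sub>m 1\<^sub>m 1) = [:- c, 1:]"
    by (simp add: char_poly_defs det_single)
  ultimately have fac: "char_poly A0 = [:- c, 1:] * char_poly B1" by simp
  have nz: "char_poly B1 \<noteq> 0"
    using degree_monic_char_poly[OF B1] by auto
  have "Polynomial.order c (char_poly A0) = 1 + Polynomial.order c (char_poly B1)"
    unfolding fac using nz by (subst order_mult) (auto simp: order_linear simp del: mult_pCons_left)
  then have "Polynomial.order c (char_poly B1) = 0"
    using simple by (simp add: simple_eigenvalue_def)
  then have "\<not> eigenvalue B1 c"
    using nz by (simp add: eigenvalue_root_char_poly[OF B1] order_root)
  moreover have "char_matrix B1 c = B1 - c \<cdot>\<^sub>m 1\<^sub>m m"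
    using B1 by (intro eq_matI) (auto simp: char_matrix_def)
  ultimately have "det (B1 - c \<cdot>\<^sub>m 1\<^sub>m m) \<noteq> 0"
    by (simp add: eigenvalue_det[OF B1])
  moreover have carr: "B1 - c \<cdot>\<^sub>m 1\<^sub>m m \<in> carrier_mat m m"
    by (intro minus_carrier_mat) simp
  ultimately show ?thesis
    using det_non_zero_imp_unit[OF carr, of "()"] mat_inverse(1)[OF carr, of "()"]
    by (cases "mat_inverse (B1 - c \<cdot>\<^sub>m 1\<^sub>m m)") auto
qed

lemma vec_mult_mat_transpose:
  fixes v :: "'a :: comm_semiring_0 vec"
  assumes "v \<in> carrier_vec (dim_row M)"
  shows "v \<^sub>v* M = transpose_mat M *\<^sub>v v"
  using assms by (intro eq_vecI) (auto simp: vec_mult_mat_def intro: comm_scalar_prod)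

section \<open>Analytic eigenvectors and their derivatives\<close>

theorem theorem2:
  fixes n :: nat
    and A0 X1 Y1 B1 X Y S :: "complex mat"
    and x0 y0 :: "complex vec"
    and lam0 \<tau>0 :: complex
    and A :: "complex \<Rightarrow> complex mat"
    and lam :: "complex \<Rightarrow> complex"
  assumes A0: "A0 \<in> carrier_mat n n"
    and simple: "simple_eigenvalue A0 lam0"
    and x0: "x0 \<in> carrier_vec n" "x0 \<noteq> 0\<^sub>v n" "A0 *\<^sub>v x0 = lam0 \<cdot>\<^sub>v x0"
    and y0: "y0 \<in> carrier_vec n" "y0 \<noteq> 0\<^sub>v n"
            "conjugate y0 \<^sub>v* A0 = lam0 \<cdot>\<^sub>v conjugate y0"
    and normalized: "conjugate y0 \<bullet> x0 = 1"
    and A: "mat_analytic_at n n A \<tau>0" "A \<tau>0 = A0"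
    and X1: "X1 \<in> carrier_mat n (n - 1)"
    and Y1: "Y1 \<in> carrier_mat n (n - 1)"
    and B1: "B1 \<in> carrier_mat (n - 1) (n - 1)"
    and X: "X = mat_of_cols n (x0 # cols X1)"
    and Y: "Y = mat_of_cols n (y0 # cols Y1)"
    and YX: "mat_adjoint Y * X = 1\<^sub>m n"
    and YA0X: "mat_adjoint Y * A0 * X =
      four_block_mat (lam0 \<cdot>\<^sub>m 1\<^sub>m 1) (0\<^sub>m 1 (n - 1)) (0\<^sub>m (n - 1) 1) B1"
    and S: "S = X1 * the (mat_inverse (B1 - lam0 \<cdot>\<^sub>m 1\<^sub>m (n - 1))) * mat_adjoint Y1"
    and lam: "lam analytic_on {\<tau>0}" "lam \<tau>0 = lam0"
             "\<forall>\<^sub>F \<tau> in nhds \<tau>0. eigenvalue (A \<tau>) (lam \<tau>)"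
  shows "\<exists>x y :: complex \<Rightarrow> complex vec.
      vec_analytic_at n x \<tau>0 \<and> vec_analytic_at n (\<lambda>\<tau>. conjugate (y \<tau>)) \<tau>0 \<and>
      x \<tau>0 = x0 \<and> y \<tau>0 = y0 \<and>
      (\<forall>\<^sub>F \<tau> in nhds \<tau>0.
         conjugate (y \<tau>) \<bullet> x \<tau> = 1 \<and>
         A \<tau> *\<^sub>v x \<tau> = lam \<tau> \<cdot>\<^sub>v x \<tau> \<and>
         conjugate (y \<tau>) \<^sub>v* A \<tau> = lam \<tau> \<cdot>\<^sub>v conjugate (y \<tau>)) \<and>
      conjugate y0 \<bullet> vec_deriv x \<tau>0 = 0 \<and>
      vec_deriv (\<lambda>\<tau>. conjugate (y \<tau>)) \<tau>0 \<bullet> x0 = 0 \<and>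
      vec_deriv x \<tau>0 = - (S * mat_deriv A \<tau>0 *\<^sub>v x0) \<and>
      vec_deriv (\<lambda>\<tau>. conjugate (y \<tau>)) \<tau>0 = - (conjugate y0 \<^sub>v* (mat_deriv A \<tau>0 * S))"


proof -
  obtain m where n: "n = Suc m"
    using x0 by (cases n) auto
  define w where "w = conjugate y0"
  have w: "w \<in> carrier_vec n" and wx: "w \<bullet> x0 = 1"
    using y0 normalized by (simp_all add: w_def)
  have adjY1: "mat_adjoint Y1 \<in> carrier_mat m n"
    using Y1 n by (intro carrier_matI) (auto simp: mat_adjoint_def)
  have Z: "mat_adjoint Y = mat_of_rows n (w # rows (mat_adjoint Y1))"
    unfolding Y w_def by (rule mat_adjoint_cons_cols[OF y0(1) Y1])
  have bd: "mat_adjoint Y * A0 * X = block_diag m lam0 B1"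
    using YA0X by (simp add: block_diag_def n)
  have Xc: "X \<in> carrier_mat n n" and Zc: "mat_adjoint Y \<in> carrier_mat n n"
    using X1 adjY1 n by (auto simp: X Z)
  have B1m: "B1 \<in> carrier_mat m m" using B1 n by simp
  have XZ: "X * mat_adjoint Y = 1\<^sub>m n"
    by (rule mat_mult_left_right_inverse[OF Zc Xc YX])
  have "X * (mat_adjoint Y * A0 * X) * mat_adjoint Y = (X * mat_adjoint Y) * A0 * (X * mat_adjoint Y)"
    using Xc Zc A0 by (simp add: assoc_mult_mat[of _ n n _ n _ n])
  then have "similar_mat A0 (block_diag m lam0 B1)"
    using A0 Xc Zc XZ YX B1m unfolding bd
    by (intro similar_matI[of _ _ X "mat_adjoint Y" n]) (auto simp: n)
  then obtain K where K: "mat_inverse (B1 - lam0 \<cdot>\<^sub>m 1\<^sub>m m) = Some K"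
    using simple_eigenvalue_deflated_invertible[OF B1m simple] by blast
  have "B1 - lam0 \<cdot>\<^sub>m 1\<^sub>m m \<in> carrier_mat m m" by (intro minus_carrier_mat) simp
  note Kinv = mat_inverse(2)[OF this K]
  have S_eq: "S = X1 * K * mat_adjoint Y1"
    using S K n by simp
  have sp: "simple_group_inverse n (A \<tau>0 - lam \<tau>0 \<cdot>\<^sub>m 1\<^sub>m n) x0 w S"
    unfolding S_eq A(2) lam(2) n
  proof (rule group_inverse_of_block_diagonal)
    show "mat_adjoint Y * A0 * X = block_diag m lam0 B1" by (rule bd)
  qed (use x0 X1 w adjY1 A0 B1m Kinv wx X Z YX n in auto)
  obtain x where x: "vec_analytic_at n x \<tau>0" "x \<tau>0 = x0"
      "\<forall>\<^sub>F s in nhds \<tau>0. A s *\<^sub>v x s = lam s \<cdot>\<^sub>v x s"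
      "w \<bullet> vec_deriv x \<tau>0 = 0" "vec_deriv x \<tau>0 = - (S * mat_deriv A \<tau>0 *\<^sub>v x0)"
    by (rule analytic_right_eigenvector[OF A(1) lam(1,3) sp])
  note D = mat_analytic_atD[OF A(1)] and T = transpose_analytic_at[OF A(1)]
  have evT: "\<forall>\<^sub>F s in nhds \<tau>0. eigenvalue (transpose_mat (A s)) (lam s)"
    using D(1) lam(3)
    by eventually_elim (simp add: eigenvalue_root_char_poly[of _ n])
  have "transpose_mat (A \<tau>0 - lam \<tau>0 \<cdot>\<^sub>m 1\<^sub>m n) = transpose_mat (A \<tau>0) - lam \<tau>0 \<cdot>\<^sub>m 1\<^sub>m n"
    using D(2) by (intro eq_matI) auto
  then have spT: "simple_group_inverse n (transpose_mat (A \<tau>0) - lam \<tau>0 \<cdot>\<^sub>m 1\<^sub>m n) w x0 (transpose_mat S)"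
    using simple_group_inverse_transpose[OF sp] by simp
  obtain z where z: "vec_analytic_at n z \<tau>0" "z \<tau>0 = w"
      "\<forall>\<^sub>F s in nhds \<tau>0. transpose_mat (A s) *\<^sub>v z s = lam s \<cdot>\<^sub>v z s"
      "x0 \<bullet> vec_deriv z \<tau>0 = 0"
      "vec_deriv z \<tau>0 = - (transpose_mat S * mat_deriv (\<lambda>s. transpose_mat (A s)) \<tau>0 *\<^sub>v w)"
    by (rule analytic_right_eigenvector[OF T(1) lam(1) evT spT])
  note Xd = vec_analytic_atD[OF x(1)] and Zd = vec_analytic_atD[OF z(1)]
  \<comment> \<open>\<open>x\<close> and \<open>z\<close> are normalized against \<open>w\<close> and \<open>x0\<close>, not against each other. Dividing \<open>x\<close> by
    \<open>p\<close> repairs this and keeps its derivative at \<open>\<tau>0\<close>, because \<open>p\<close> is stationary there.\<close>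
  define p where "p s = z s \<bullet> x s" for s
  have p_an: "p analytic_on {\<tau>0}" and p': "deriv p \<tau>0 = 0"
  proof -
    show "p analytic_on {\<tau>0}"
      unfolding p_def by (rule analytic_at_scalar_prod(1)[OF z(1) x(1)])
    show "deriv p \<tau>0 = 0"
      unfolding p_def analytic_at_scalar_prod(2)[OF z(1) x(1)]
      using x(2,4) z(2,4) comm_scalar_prod[OF x0(1) Zd(5)] by simp
  qed
  have p0: "p \<tau>0 = 1" using x(2) z(2) wx by (simp add: p_def)
  define q where "q s = inverse (p s)" for s
  have q_an: "q analytic_on {\<tau>0}"
    unfolding q_def using p0 by (intro analytic_on_inverse p_an) auto
  have "(q has_field_derivative - (inverse (p \<tau>0) * deriv p \<tau>0 * inverse (p \<tau>0))) (at \<tau>0)"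
    unfolding q_def using p0 by (intro DERIV_inverse' analytic_at_has_deriv p_an) auto
  then have q': "deriv q \<tau>0 = 0"
    using p' by (simp add: DERIV_imp_deriv)
  have p_nz: "\<forall>\<^sub>F s in nhds \<tau>0. p s \<noteq> 0"
    using p0 by (intro analytic_at_eventually_nonzero[OF p_an]) simp
  define x' where "x' s = q s \<cdot>\<^sub>v x s" for s
  define y where "y s = conjugate (z s)" for s
  have cy: "conjugate (y s) = z s" for s by (simp add: y_def)
  have x'_an: "vec_analytic_at n x' \<tau>0"
    unfolding x'_def by (rule vec_analytic_at_smult(1)[OF q_an x(1)])
  have x'_d: "vec_deriv x' \<tau>0 = vec_deriv x \<tau>0"
    unfolding x'_def vec_analytic_at_smult(2)[OF q_an x(1)]
    using q' p0 Xd by (intro eq_vecI) (auto simp: q_def)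
  have x'0: "x' \<tau>0 = x0"
    using x(2) p0 by (simp add: x'_def q_def)
  have y0': "y \<tau>0 = y0"
    by (simp add: y_def z(2) w_def)
  have ev: "\<forall>\<^sub>F s in nhds \<tau>0. z s \<bullet> x' s = 1 \<and> A s *\<^sub>v x' s = lam s \<cdot>\<^sub>v x' s \<and>
      z s \<^sub>v* A s = lam s \<cdot>\<^sub>v z s"
    using p_nz D(1) Xd(1) Zd(1) x(3) z(3)
  proof eventually_elim
    case (elim s)
    have "z s \<bullet> x' s = q s * p s"
      using elim by (simp add: x'_def p_def)
    moreover have "A s *\<^sub>v x' s = lam s \<cdot>\<^sub>v x' s"
      unfolding x'_def mult_mat_vec[OF elim(2,3)] elim(5) by (simp add: smult_smult_assoc mult.commute)
    moreover have "z s \<^sub>v* A s = lam s \<cdot>\<^sub>v z s"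
      using elim by (simp add: vec_mult_mat_transpose)
    ultimately show ?case using elim(1) by (simp add: q_def)
  qed
  have Sc: "S \<in> carrier_mat n n"
    using sp by (simp add: simple_group_inverse_def)
  have "vec_deriv z \<tau>0 = - (transpose_mat (mat_deriv A \<tau>0 * S) *\<^sub>v w)"
    using z(5) T(2) transpose_mult[OF D(4) Sc] by simp
  then have z': "vec_deriv z \<tau>0 = - (conjugate y0 \<^sub>v* (mat_deriv A \<tau>0 * S))"
    using D(4) w by (simp add: vec_mult_mat_transpose w_def)
  have z'x0: "vec_deriv z \<tau>0 \<bullet> x0 = 0"
    using z(4) comm_scalar_prod[OF x0(1) Zd(5)] by simp
  show ?thesis
    by (rule exI[of _ x'], rule exI[of _ y])
      (use x'_an z(1) x'0 y0' ev x(4,5) x'_d z' z'x0 in \<open>simp add: cy w_def\<close>)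
qed

end
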